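(* Let $A$ be a unital associative algebra over a field $\mathbf{k}$ and let $n\geq 1$ be an integer. Assume that there exists a pair $(\phi,F)$ of a skew field $F$ and an injective ring morphism $\phi: A^{\otimes n}\hookrightarrow F$; identify elements of $A^{\otimes n}$ with their images under $\phi$. Let $f_0,\ldots,f_n$ be linearly independent elements of $A$, and for $i=0,\ldots,n$ set $$\Delta_i=[f_0,\ldots,\check f_i,\ldots,f_n]\in A^{\otimes n}.$$ Then $\Delta_0\neq 0$, and the elements $H_i=(\Delta_0)^{-1}\Delta_i$ ($i=0,\ldots,n$) of $F$ commute: $H_iH_j=H_jH_i$ for any $i,j$.
   Context: Tensor powers are over the base field $\mathbf{k}$, with the usual tensor product algebra structure. For $g_1,\ldots,g_n\in A$, set $$[g_1,\ldots,g_n]=\sum_{\sigma\in\mathfrak{S}_n}\epsilon(\sigma)\,g_{\sigma(1)}\otimes\cdots\otimes g_{\sigma(n)}\in A^{\otimes n},$$ where $\epsilon(\sigma)$ is the sign of the permutation $\sigma$. The notation $\check f_i$ means that $f_i$ is omitted. A skew field is a unital algebra (ring) in which each nonzero element is invertible. *)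

theory Defs
  imports
    "HOL-Algebra.QuotRing"
    "HOL-Algebra.Algebraic_Closure_Type"
    "HOL-Library.Poly_Mapping"
    "HOL-Library.FuncSet"
    "HOL-Combinatorics.Permutations"
begin

text \<open>
  The library's locale \<open>algebra\<close> is about commutative algebras, hence the following one.
\<close>

locale unital_assoc_algebra = vector_space scale
  for scale :: "'k::field \<Rightarrow> 'a::ring_1 \<Rightarrow> 'a" +
  assumes scale_mult_left: "scale c (x * y) = scale c x * y"
    and scale_mult_right: "scale c (x * y) = x * scale c y"

text \<open>
  The tensor power is the free vector space on the set of \<open>n\<close>-tuples of elements of the algebra
  (the functions on \<open>{1..n}\<close>, \<^const>\<open>undefined\<close> elsewhere) modulo the span of the
  multilinearity relations. The free vector space carries the bilinear product given on basis
  elements by the componentwise product of tuples, and the quotient carries the induced product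
  \<open>(x\<^sub>1 \<otimes> \<dots> \<otimes> x\<^sub>n) (y\<^sub>1 \<otimes> \<dots> \<otimes> y\<^sub>n) = x\<^sub>1 y\<^sub>1 \<otimes> \<dots> \<otimes> x\<^sub>n y\<^sub>n\<close>.
\<close>

definition tuples :: "nat \<Rightarrow> (nat \<Rightarrow> 'a) set" where
  "tuples n = {1..n} \<rightarrow>\<^sub>E UNIV"

definition tuple_mult :: "nat \<Rightarrow> (nat \<Rightarrow> 'a::ring_1) \<Rightarrow> (nat \<Rightarrow> 'a) \<Rightarrow> nat \<Rightarrow> 'a" where
  "tuple_mult n g h = (\<lambda>i\<in>{1..n}. g i * h i)"

definition free_mult ::
  "nat \<Rightarrow> ((nat \<Rightarrow> 'a::ring_1) \<Rightarrow>\<^sub>0 'k::field) \<Rightarrow> ((nat \<Rightarrow> 'a) \<Rightarrow>\<^sub>0 'k) \<Rightarrow> ((nat \<Rightarrow> 'a) \<Rightarrow>\<^sub>0 'k)" where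
  "free_mult n p q =
     (\<Sum>g\<in>Poly_Mapping.keys p. \<Sum>h\<in>Poly_Mapping.keys q.
        Poly_Mapping.single (tuple_mult n g h)
          (Poly_Mapping.lookup p g * Poly_Mapping.lookup q h))"

definition free_algebra :: "nat \<Rightarrow> ((nat \<Rightarrow> 'a::ring_1) \<Rightarrow>\<^sub>0 'k::field) ring" where
  "free_algebra n =
     \<lparr>carrier = {p. Poly_Mapping.keys p \<subseteq> tuples n},
      monoid.mult = free_mult n,
      one = Poly_Mapping.single (\<lambda>i\<in>{1..n}. 1) 1,
      ring.zero = 0,
      add = (+)\<rparr>"

definition free_scale :: "'k::field \<Rightarrow> ('x \<Rightarrow>\<^sub>0 'k) \<Rightarrow> ('x \<Rightarrow>\<^sub>0 'k)" where
  "free_scale c = Poly_Mapping.map ((*) c)"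

definition free_basis :: "nat \<Rightarrow> (nat \<Rightarrow> 'a) \<Rightarrow> ((nat \<Rightarrow> 'a) \<Rightarrow>\<^sub>0 'k::field)" where
  "free_basis n g = Poly_Mapping.single (restrict g {1..n}) 1"

definition multilinear_relations ::
  "('k::field \<Rightarrow> 'a::ring_1 \<Rightarrow> 'a) \<Rightarrow> nat \<Rightarrow> ((nat \<Rightarrow> 'a) \<Rightarrow>\<^sub>0 'k) set" where
  "multilinear_relations scale n =
     {free_basis n (g(i := x + y)) - (free_basis n (g(i := x)) + free_basis n (g(i := y)))
       | g i x y. i \<in> {1..n}} \<union>
     {free_basis n (g(i := scale c x)) - free_scale c (free_basis n (g(i := x)))
       | g i c x. i \<in> {1..n}}"

definition tensor_kernel ::
  "('k::field \<Rightarrow> 'a::ring_1 \<Rightarrow> 'a) \<Rightarrow> nat \<Rightarrow> ((nat \<Rightarrow> 'a) \<Rightarrow>\<^sub>0 'k) set" where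
  "tensor_kernel scale n = module.span free_scale (multilinear_relations scale n)"

definition tensor_power ::
  "('k::field \<Rightarrow> 'a::ring_1 \<Rightarrow> 'a) \<Rightarrow> nat \<Rightarrow> ((nat \<Rightarrow> 'a) \<Rightarrow>\<^sub>0 'k) set ring" where
  "tensor_power scale n = free_algebra n Quot tensor_kernel scale n"

text \<open>\<open>g 1 \<otimes> \<dots> \<otimes> g n\<close>\<close>

definition pure_tensor ::
  "('k::field \<Rightarrow> 'a::ring_1 \<Rightarrow> 'a) \<Rightarrow> nat \<Rightarrow> (nat \<Rightarrow> 'a) \<Rightarrow> ((nat \<Rightarrow> 'a) \<Rightarrow>\<^sub>0 'k) set" where
  "pure_tensor scale n g = tensor_kernel scale n +>\<^bsub>free_algebra n\<^esub> free_basis n g"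

text \<open>\<open>[g 1, \<dots>, g n]\<close>\<close>

definition antisym_tensor ::
  "('k::field \<Rightarrow> 'a::ring_1 \<Rightarrow> 'a) \<Rightarrow> nat \<Rightarrow> (nat \<Rightarrow> 'a) \<Rightarrow> ((nat \<Rightarrow> 'a) \<Rightarrow>\<^sub>0 'k) set" where
  "antisym_tensor scale n g =
     (\<Oplus>\<^bsub>tensor_power scale n\<^esub>\<sigma>\<in>{\<sigma>. \<sigma> permutes {1..n}}.
        [sign \<sigma>] \<cdot>\<^bsub>tensor_power scale n\<^esub> pure_tensor scale n (g \<circ> \<sigma>))"

text \<open>
  The family \<open>f 0, f 1, \<dots>\<close> with \<open>f i\<close> left out, renumbered so as to start at index 1.
\<close>

definition omit :: "nat \<Rightarrow> (nat \<Rightarrow> 'a) \<Rightarrow> nat \<Rightarrow> 'a" where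
  "omit i f = (\<lambda>j. if j \<le> i then f (j - 1) else f j)"

definition Delta ::
  "('k::field \<Rightarrow> 'a::ring_1 \<Rightarrow> 'a) \<Rightarrow> nat \<Rightarrow> (nat \<Rightarrow> 'a) \<Rightarrow> nat \<Rightarrow> ((nat \<Rightarrow> 'a) \<Rightarrow>\<^sub>0 'k) set" where
  "Delta scale n f i = antisym_tensor scale n (omit i f)"


text \<open>
  The quotient is well defined: the span of the relations is a two-sided ideal.
\<close>

lemma lookup_free_scale [simp]:
  "Poly_Mapping.lookup (free_scale c p) x = c * Poly_Mapping.lookup p x"
  by (simp add: free_scale_def Poly_Mapping.map.rep_eq when_def)

lemma keys_free_scale: "Poly_Mapping.keys (free_scale c p) \<subseteq> Poly_Mapping.keys p"
  by (auto simp: in_keys_iff)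

lemma vector_space_free_scale: "vector_space (free_scale :: 'k::field \<Rightarrow> ('x \<Rightarrow>\<^sub>0 'k) \<Rightarrow> _)"
  by unfold_locales (auto intro!: poly_mapping_eqI simp: lookup_add algebra_simps)

interpretation free: vector_space "free_scale :: 'k::field \<Rightarrow> ('x \<Rightarrow>\<^sub>0 'k) \<Rightarrow> _"
  by (rule vector_space_free_scale)

lemma free_mult_add_left: "free_mult n (p + p') q = free_mult n p q + free_mult n p' q"
  unfolding free_mult_def
  by (rule setsum_keys_plus_distrib)
    (simp_all add: single_add sum.distrib algebra_simps)

lemma free_mult_add_right: "free_mult n p (q + q') = free_mult n p q + free_mult n p q'"
  unfolding free_mult_def sum.distrib [symmetric]
  by (rule sum.cong [OF refl], rule setsum_keys_plus_distrib)
    (simp_all add: single_add algebra_simps)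

lemma free_mult_zero [simp]: "free_mult n 0 q = 0" "free_mult n p 0 = 0"
  by (simp_all add: free_mult_def)

lemma free_mult_single:
  "free_mult n (Poly_Mapping.single g a) (Poly_Mapping.single h b) =
     Poly_Mapping.single (tuple_mult n g h) (a * b)"
  by (simp add: free_mult_def)

lemma free_mult_diff_left: "free_mult n (p - p') q = free_mult n p q - free_mult n p' q"
  using free_mult_add_left [of n "p - p'" p' q] by (simp add: algebra_simps)

lemma free_mult_diff_right: "free_mult n p (q - q') = free_mult n p q - free_mult n p q'"
  using free_mult_add_right [of n p "q - q'" q'] by (simp add: algebra_simps)

lemma poly_mapping_single_induct [case_names zero single add]:
  fixes p :: "'x \<Rightarrow>\<^sub>0 'b::comm_monoid_add"
  assumes "P 0" "\<And>x a. x \<in> S \<Longrightarrow> P (Poly_Mapping.single x a)"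
    "\<And>p q. P p \<Longrightarrow> P q \<Longrightarrow> P (p + q)"
    and "Poly_Mapping.keys p \<subseteq> S"
  shows "P p"
proof -
  have "P (\<Sum>x\<in>Y. Poly_Mapping.single x (Poly_Mapping.lookup p x))"
    if "finite Y" "Y \<subseteq> S" for Y
    using that by (induction rule: finite_induct) (auto intro: assms)
  moreover have "(\<Sum>x\<in>Poly_Mapping.keys p. Poly_Mapping.single x (Poly_Mapping.lookup p x)) = p"
    by (rule poly_mapping_eqI)
      (auto simp: lookup_sum lookup_single when_def sum.delta in_keys_iff)
  ultimately show ?thesis
    using assms(4) by (metis finite_keys)
qed

lemma free_mult_assoc:
  "free_mult n (free_mult n p q) r = free_mult n p (free_mult n q r)"
proof (induction p rule: poly_mapping_single_induct [where S = UNIV])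
  case (single g a)
  show ?case
  proof (induction q rule: poly_mapping_single_induct [where S = UNIV])
    case (single h b)
    show ?case
      by (induction r rule: poly_mapping_single_induct [where S = UNIV])
        (simp_all add: free_mult_single free_mult_add_right tuple_mult_def mult.assoc cong: restrict_cong)
  qed (simp_all add: free_mult_add_right free_mult_add_left)
qed (simp_all add: free_mult_add_left)

lemma free_mult_one:
  assumes "Poly_Mapping.keys p \<subseteq> tuples n"
  shows "free_mult n (Poly_Mapping.single (\<lambda>i\<in>{1..n}. 1) 1) p = p"
    and "free_mult n p (Poly_Mapping.single (\<lambda>i\<in>{1..n}. 1) 1) = p"
proof -
  have *: "tuple_mult n (\<lambda>i\<in>{1..n}. 1) g = g" "tuple_mult n g (\<lambda>i\<in>{1..n}. 1) = g"
    if "g \<in> tuples n" for g :: "nat \<Rightarrow> 'a"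
    using that by (auto simp: tuple_mult_def tuples_def PiE_def extensional_def fun_eq_iff)
  show "free_mult n (Poly_Mapping.single (\<lambda>i\<in>{1..n}. 1) 1) p = p"
    by (rule poly_mapping_single_induct [OF _ _ _ assms])
      (simp_all add: free_mult_add_right free_mult_single * del: One_nat_def restrict_apply)
  show "free_mult n p (Poly_Mapping.single (\<lambda>i\<in>{1..n}. 1) 1) = p"
    by (rule poly_mapping_single_induct [OF _ _ _ assms])
      (simp_all add: free_mult_add_left free_mult_single * del: One_nat_def restrict_apply)
qed

lemma restrict_in_tuples [simp]: "restrict g {1..n} \<in> tuples n"
  by (simp add: tuples_def)

lemma tuple_mult_in_tuples [simp]: "tuple_mult n g h \<in> tuples n"
  by (simp add: tuple_mult_def del: One_nat_def)

lemma keys_free_mult: "Poly_Mapping.keys (free_mult n p q) \<subseteq> tuples n"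
  unfolding free_mult_def
  by (rule order.trans [OF keys_sum] UN_least)+ (simp add: tuple_mult_in_tuples)

lemma ring_free_algebra: "ring (free_algebra n :: ((nat \<Rightarrow> 'a::ring_1) \<Rightarrow>\<^sub>0 'k::field) ring)"
proof (rule ringI)
  let ?R = "free_algebra n :: ((nat \<Rightarrow> 'a) \<Rightarrow>\<^sub>0 'k) ring"
  show "abelian_group ?R"
  proof (rule abelian_groupI)
    show "\<exists>q\<in>carrier ?R. q \<oplus>\<^bsub>?R\<^esub> p = \<zero>\<^bsub>?R\<^esub>" if "p \<in> carrier ?R" for p
      using that by (intro bexI [of _ "- p"]) (auto simp: free_algebra_def)
    show "p \<oplus>\<^bsub>?R\<^esub> q \<in> carrier ?R" if "p \<in> carrier ?R" "q \<in> carrier ?R" for p q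
      using that keys_add [of p q] by (auto simp: free_algebra_def)
  qed (simp_all add: free_algebra_def ac_simps)
  show "monoid ?R"
    by (rule monoidI)
      (auto simp: free_algebra_def free_mult_assoc free_mult_one simp del: One_nat_def dest: subsetD [OF keys_free_mult])
qed (simp_all add: free_algebra_def free_mult_add_left free_mult_add_right)

lemma tuple_mult_upd:
  assumes "i \<in> {1..n}"
  shows "tuple_mult n g (restrict (h(i := x)) {1..n}) =
           restrict ((\<lambda>j. g j * h j)(i := g i * x)) {1..n}"
    and "tuple_mult n (restrict (h(i := x)) {1..n}) g =
           restrict ((\<lambda>j. h j * g j)(i := x * g i)) {1..n}"
  using assms by (auto simp: tuple_mult_def fun_eq_iff)

lemma free_scale_single:
  "free_scale c (Poly_Mapping.single g a) = Poly_Mapping.single g (c * a)"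
  by (rule poly_mapping_eqI) (simp add: lookup_single when_def)

lemma free_scale_diff: "free_scale c (p - q) = free_scale c p - free_scale c q"
  by (rule free.scale_right_diff_distrib)

lemma free_mult_scale:
  "free_mult n p (free_scale c q) = free_scale c (free_mult n p q)"
  "free_mult n (free_scale c p) q = free_scale c (free_mult n p q)"
proof -
  show "free_mult n p (free_scale c q) = free_scale c (free_mult n p q)"
  proof (induction p rule: poly_mapping_single_induct [where S = UNIV])
    case (single g a)
    show ?case
      by (induction q rule: poly_mapping_single_induct [where S = UNIV])
        (simp_all add: free_mult_single free_scale_single free_mult_add_right
          free.scale_right_distrib ac_simps)
  qed (simp_all add: free_mult_add_left free.scale_right_distrib)
  show "free_mult n (free_scale c p) q = free_scale c (free_mult n p q)"
  proof (induction p rule: poly_mapping_single_induct [where S = UNIV])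
    case (single g a)
    show ?case
      by (induction q rule: poly_mapping_single_induct [where S = UNIV])
        (simp_all add: free_mult_single free_scale_single free_mult_add_right
          free.scale_right_distrib ac_simps)
  qed (simp_all add: free_mult_add_left free.scale_right_distrib)
qed

lemma single_eq_free_scale: "Poly_Mapping.single g a = free_scale a (Poly_Mapping.single g 1)"
  by (simp add: free_scale_single)

context unital_assoc_algebra
begin

lemma tensor_kernel_subspace: "free.subspace (tensor_kernel scale n)"
  unfolding tensor_kernel_def by (rule free.subspace_span)

lemma free_basis_mult_relation:
  assumes "r \<in> multilinear_relations scale n"
  shows "free_mult n (Poly_Mapping.single g 1) r \<in> multilinear_relations scale n"
    and "free_mult n r (Poly_Mapping.single g 1) \<in> multilinear_relations scale n"
proof -
  consider h i x y where "i \<in> {1..n}"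
      "r = free_basis n (h(i := x + y)) - (free_basis n (h(i := x)) + free_basis n (h(i := y)))"
    | h i c x where "i \<in> {1..n}"
      "r = free_basis n (h(i := scale c x)) - free_scale c (free_basis n (h(i := x)))"
    using assms unfolding multilinear_relations_def by blast
  then have "free_mult n (Poly_Mapping.single g 1) r \<in> multilinear_relations scale n \<and>
      free_mult n r (Poly_Mapping.single g 1) \<in> multilinear_relations scale n"
  proof cases
    case 1
    have "free_mult n (Poly_Mapping.single g 1) r =
        free_basis n ((\<lambda>j. g j * h j)(i := g i * x + g i * y)) -
        (free_basis n ((\<lambda>j. g j * h j)(i := g i * x)) + free_basis n ((\<lambda>j. g j * h j)(i := g i * y)))"
      using 1 by (simp add: free_basis_def free_mult_diff_right free_mult_add_right
          free_mult_single tuple_mult_upd distrib_left del: atLeastAtMost_iff One_nat_def)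
    moreover have "free_mult n r (Poly_Mapping.single g 1) =
        free_basis n ((\<lambda>j. h j * g j)(i := x * g i + y * g i)) -
        (free_basis n ((\<lambda>j. h j * g j)(i := x * g i)) + free_basis n ((\<lambda>j. h j * g j)(i := y * g i)))"
      using 1 by (simp add: free_basis_def free_mult_diff_left free_mult_add_left
          free_mult_single tuple_mult_upd distrib_right del: atLeastAtMost_iff One_nat_def)
    ultimately show ?thesis
      using 1(1) unfolding multilinear_relations_def by blast
  next
    case 2
    have "free_mult n (Poly_Mapping.single g 1) r =
        free_basis n ((\<lambda>j. g j * h j)(i := scale c (g i * x))) -
        free_scale c (free_basis n ((\<lambda>j. g j * h j)(i := g i * x)))"
      using 2 by (simp add: free_basis_def free_mult_diff_right free_mult_scale
          free_mult_single tuple_mult_upd scale_mult_right del: atLeastAtMost_iff One_nat_def)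
    moreover have "free_mult n r (Poly_Mapping.single g 1) =
        free_basis n ((\<lambda>j. h j * g j)(i := scale c (x * g i))) -
        free_scale c (free_basis n ((\<lambda>j. h j * g j)(i := x * g i)))"
      using 2 by (simp add: free_basis_def free_mult_diff_left free_mult_scale
          free_mult_single tuple_mult_upd scale_mult_left del: atLeastAtMost_iff One_nat_def)
    ultimately show ?thesis
      using 2(1) unfolding multilinear_relations_def by blast
  qed
  then show "free_mult n (Poly_Mapping.single g 1) r \<in> multilinear_relations scale n"
    and "free_mult n r (Poly_Mapping.single g 1) \<in> multilinear_relations scale n"
    by blast+
qed

lemma free_mult_tensor_kernel:
  assumes "t \<in> tensor_kernel scale n"
  shows "free_mult n p t \<in> tensor_kernel scale n" "free_mult n t p \<in> tensor_kernel scale n"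
proof -
  let ?K = "tensor_kernel scale n"
  note sub = tensor_kernel_subspace [of n]
  have single: "free_mult n (Poly_Mapping.single g a) t \<in> ?K \<and>
      free_mult n t (Poly_Mapping.single g a) \<in> ?K" for g a
    using assms unfolding tensor_kernel_def
  proof (induction rule: free.span_induct_alt)
    case base
    show ?case by (simp add: free.span_zero)
  next
    case (step c r u)
    have "free_mult n (Poly_Mapping.single g a) r \<in> free.span (multilinear_relations scale n)"
      "free_mult n r (Poly_Mapping.single g a) \<in> free.span (multilinear_relations scale n)"
      by (subst single_eq_free_scale,
          simp add: free_mult_scale free.span_scale free.span_base free_basis_mult_relation step)+
    with step show ?case
      by (auto simp: free_mult_add_left free_mult_add_right free_mult_scale
          intro!: free.span_add free.span_scale)
  qed
  have "free_mult n p t \<in> ?K \<and> free_mult n t p \<in> ?K"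
    by (induction p rule: poly_mapping_single_induct [where S = UNIV])
      (use single sub in \<open>auto simp: free_mult_add_left free_mult_add_right
          free.subspace_0 free.subspace_add\<close>)
  then show "free_mult n p t \<in> ?K" "free_mult n t p \<in> ?K" by blast+
qed

lemma tensor_kernel_carrier: "tensor_kernel scale n \<subseteq> carrier (free_algebra n)"
proof -
  let ?C = "{p :: (nat \<Rightarrow> 'a) \<Rightarrow>\<^sub>0 'k. Poly_Mapping.keys p \<subseteq> tuples n}"
  have basis: "free_basis n g \<in> ?C" for g
    by (simp add: free_basis_def del: One_nat_def)
  have subspace: "free.subspace ?C"
    unfolding free.subspace_def mem_Collect_eq
    by (auto dest: subsetD [OF keys_add] subsetD [OF keys_free_scale])
  have "multilinear_relations scale n \<subseteq> ?C"
  proof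
    fix r assume "r \<in> multilinear_relations scale n"
    then consider h i x y where
        "r = free_basis n (h(i := x + y)) - (free_basis n (h(i := x)) + free_basis n (h(i := y)))"
      | h i c x where
        "r = free_basis n (h(i := scale c x)) - free_scale c (free_basis n (h(i := x)))"
      unfolding multilinear_relations_def by blast
    then show "r \<in> ?C"
    proof cases
      case 1
      show ?thesis
        unfolding 1 by (intro free.subspace_diff [OF subspace] free.subspace_add [OF subspace] basis)
    next
      case 2
      show ?thesis
        unfolding 2 by (intro free.subspace_diff [OF subspace] free.subspace_scale [OF subspace] basis)
    qed
  qed
  then show ?thesis
    unfolding tensor_kernel_def by (simp add: free_algebra_def free.span_minimal subspace)
qed

lemma ideal_tensor_kernel: "ideal (tensor_kernel scale n) (free_algebra n)"
proof (rule idealI)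
  let ?R = "free_algebra n :: ((nat \<Rightarrow> 'a) \<Rightarrow>\<^sub>0 'k) ring"
  interpret R: ring ?R by (rule ring_free_algebra)
  show "ring ?R" by (rule R.ring_axioms)
  show "subgroup (tensor_kernel scale n) (add_monoid ?R)"
  proof (rule R.add.subgroupI)
    show "\<ominus>\<^bsub>?R\<^esub> p \<in> tensor_kernel scale n" if "p \<in> tensor_kernel scale n" for p
    proof -
      have "- p \<in> tensor_kernel scale n"
        using that tensor_kernel_subspace free.subspace_neg by blast
      moreover have "\<ominus>\<^bsub>?R\<^esub> p = - p"
        by (rule R.minus_equality)
          (use that calculation tensor_kernel_carrier in \<open>auto simp: free_algebra_def\<close>)
      ultimately show ?thesis by simp
    qed
    show "tensor_kernel scale n \<noteq> {}"
      using tensor_kernel_subspace free.subspace_0 by blast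
  qed (use tensor_kernel_carrier tensor_kernel_subspace in
      \<open>auto simp: free_algebra_def free.subspace_def\<close>)
qed (auto simp: free_algebra_def free_mult_tensor_kernel)

lemma ring_tensor_power: "ring (tensor_power scale n)"
  unfolding tensor_power_def by (rule ideal.quotient_is_ring [OF ideal_tensor_kernel])

lemma one_tensor_power: "\<one>\<^bsub>tensor_power scale n\<^esub> = pure_tensor scale n (\<lambda>_. 1)"
  by (simp add: tensor_power_def FactRing_def pure_tensor_def free_algebra_def free_basis_def)

lemma pure_tensor_mult:
  "pure_tensor scale n g \<otimes>\<^bsub>tensor_power scale n\<^esub> pure_tensor scale n h =
     pure_tensor scale n (\<lambda>i. g i * h i)"
proof -
  interpret I: ideal "tensor_kernel scale n" "free_algebra n"
    by (rule ideal_tensor_kernel)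
  have *: "free_basis n g \<in> carrier (free_algebra n :: ((nat \<Rightarrow> 'a) \<Rightarrow>\<^sub>0 'k) ring)" for g
    by (simp add: free_algebra_def free_basis_def del: One_nat_def)
  have "free_basis n g \<otimes>\<^bsub>free_algebra n\<^esub> free_basis n h =
      (free_basis n (\<lambda>i. g i * h i) :: (nat \<Rightarrow> 'a) \<Rightarrow>\<^sub>0 'k)"
    by (simp add: free_algebra_def free_basis_def free_mult_single tuple_mult_def cong: restrict_cong)
  then show ?thesis
    by (simp add: tensor_power_def FactRing_def pure_tensor_def I.rcoset_mult_add *)
qed

end

end

theory Submission
  imports Defs
begin

text \<open>
  Let \<open>b k x\<close> be the image in the skew field of the pure tensor with \<open>x\<close> in slot \<open>k\<close> and 1 elsewhere.
  In the matrix of the \<open>b k (f i)\<close>, entries in different rows commute, so its determinant is well behaved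
  under column operations: it expands along one or two columns, and vanishes if two columns agree.
  Expansion along one column yields a left inverse of the square matrix of the \<open>b k (f i)\<close> with
  \<open>1 \<le> i \<le> n\<close>, which over a skew field is also a right inverse; hence, up to signs, the \<open>H i\<close> solve
  \<open>\<Sum>i. b k (f i) * H i = b k (f 0)\<close>. For \<open>k \<noteq> l\<close> this gives
  \<open>\<Sum>p q. b k (f p) * b l (f q) * H p * H q = b k (f 0) * b l (f 0)\<close>. Multiplying by the complementary
  cofactors for the columns \<open>i\<close> and \<open>j\<close> and summing over \<open>k\<close> and \<open>l\<close>, the right side becomes a determinant
  with two columns \<open>f 0\<close>, that is 0, and the left side becomes \<open>\<Delta>\<^sub>0 * (H i * H j - H j * H i)\<close>.
  That \<open>\<Delta>\<^sub>0\<close> is nonzero is seen by applying the product of the dual coordinate functionals.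
\<close>

section \<open>Linear systems over a skew field\<close>

text \<open>Gaussian elimination, by induction on \<open>n\<close>: if some
  \<open>a m (Suc n)\<close> is nonzero, the last equation is solved for the unknown
  \<open>m\<close>. Unknowns stay on the left of the coefficients, so each elimination multiplies on
  the right by \<open>inverse p * a m i\<close>.\<close>

lemma homogeneous_system_nontrivial:
  fixes a :: "nat \<Rightarrow> nat \<Rightarrow> 'f::division_ring"
  shows "\<exists>x. (\<exists>j\<le>n. x j \<noteq> 0) \<and> (\<forall>i\<in>{1..n}. (\<Sum>j\<le>n. x j * a j i) = 0)"
proof (induction n arbitrary: a)
  case 0
  show ?case by (rule exI [of _ "\<lambda>_. 1"]) simp
next
  case (Suc n)
  show ?case
  proof (cases "\<forall>j\<le>Suc n. a j (Suc n) = 0")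
    case True
    \<comment> \<open>The last equation is vacuous, so a solution of the other equations is extended
      by 0.\<close>
    obtain x where x: "\<exists>j\<le>n. x j \<noteq> 0" "\<forall>i\<in>{1..n}. (\<Sum>j\<le>n. x j * a j i) = 0"
      using Suc.IH [of a] by blast
    have "(\<Sum>j\<le>Suc n. (x(Suc n := 0)) j * a j i) = (\<Sum>j\<le>n. x j * a j i)" for i
      by simp
    then have "(\<Sum>j\<le>Suc n. (x(Suc n := 0)) j * a j i) = 0" if "i \<in> {1..Suc n}" for i
      using x(2) True that by (cases "i = Suc n") (simp_all del: sum.atMost_Suc)
    moreover have "\<exists>j\<le>Suc n. (x(Suc n := 0)) j \<noteq> 0"
    proof -
      obtain j where "j \<le> n" "x j \<noteq> 0" using x(1) by blast
      then show ?thesis by (intro exI [of _ j]) auto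
    qed
    ultimately show ?thesis by (intro exI [of _ "x(Suc n := 0)"]) blast
  next
    case False
    then obtain m where m: "m \<le> Suc n" "a m (Suc n) \<noteq> 0" by blast
    \<comment> \<open>Exchanges the pivot unknown with the last one, since the induction hypothesis
      concerns the unknowns up to \<open>n\<close>.\<close>
    define \<tau> where "\<tau> = transpose m (Suc n)"
    define p where "p = a m (Suc n)"
    define a' where "a' j i = a (\<tau> j) i - a (\<tau> j) (Suc n) * inverse p * a m i" for j i
    obtain x where x: "\<exists>j\<le>n. x j \<noteq> 0" "\<forall>i\<in>{1..n}. (\<Sum>j\<le>n. x j * a' j i) = 0"
      using Suc.IH [of a'] by blast
    \<comment> \<open>The value that the last equation forces on the pivot unknown; substituting it
      turns the other equations into those of \<open>a'\<close>.\<close>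
    define t where "t = - (\<Sum>j\<le>n. x j * a (\<tau> j) (Suc n)) * inverse p"
    define y where "y = x(Suc n := t)"
    have perm: "\<tau> permutes {..Suc n}"
      using m by (auto simp: \<tau>_def intro!: permutes_swap_id)
    have \<tau>\<tau>: "\<tau> (\<tau> j) = j" for j by (simp add: \<tau>_def)
    have eq: "(\<Sum>j\<le>Suc n. y (\<tau> j) * a j i) = (\<Sum>j\<le>n. x j * a (\<tau> j) i) + t * a m i" for i
    proof -
      have "(\<Sum>j\<le>Suc n. y (\<tau> j) * a j i) = (\<Sum>j\<le>Suc n. y j * a (\<tau> j) i)"
        by (subst sum.permute [OF perm]) (simp add: \<tau>\<tau> o_def del: sum.atMost_Suc)
      also have "\<dots> = (\<Sum>j\<le>n. x j * a (\<tau> j) i) + t * a m i"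
        by (simp add: y_def \<tau>_def)
      finally show ?thesis .
    qed
    have "(\<Sum>j\<le>Suc n. y (\<tau> j) * a j i) = 0" if i: "i \<in> {1..Suc n}" for i
    proof (cases "i = Suc n")
      case True
      show ?thesis unfolding eq True using m
        by (simp add: t_def p_def mult.assoc)
    next
      case False
      with x(2) i have "(\<Sum>j\<le>n. x j * a' j i) = 0" by simp
      then show ?thesis unfolding eq t_def a'_def
        by (simp add: sum_subtractf sum_distrib_right right_diff_distrib mult.assoc)
    qed
    moreover have "\<exists>j\<le>Suc n. y (\<tau> j) \<noteq> 0"
    proof -
      obtain j where j: "j \<le> n" "x j \<noteq> 0" using x(1) by blast
      then have "y (\<tau> (\<tau> j)) \<noteq> 0" "\<tau> j \<le> Suc n"
        using permutes_in_image [OF perm, of j] by (auto simp: \<tau>\<tau> y_def)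
      then show ?thesis by blast
    qed
    ultimately show ?thesis by (intro exI [of _ "\<lambda>j. y (\<tau> j)"]) blast
  qed
qed

text \<open>The \<open>k\<close>-th unit row and the \<open>n\<close> rows of \<open>C\<close> are
  \<open>n + 1\<close> vectors of length \<open>n\<close>, hence linearly dependent. The unit row
  occurs with nonzero coefficient, so it is \<open>y C\<close> for some row \<open>y\<close>;
  multiplying by \<open>B\<close> identifies \<open>y\<close> with row \<open>k\<close> of
  \<open>B\<close>.\<close>

lemma left_inverse_imp_right_inverse:
  fixes B C :: "nat \<Rightarrow> nat \<Rightarrow> 'f::division_ring"
  assumes CB: "\<And>i j. i \<in> {1..n} \<Longrightarrow> j \<in> {1..n} \<Longrightarrow>
      (\<Sum>k\<in>{1..n}. C i k * B k j) = (if i = j then 1 else 0)"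
    and k: "k \<in> {1..n}" and l: "l \<in> {1..n}"
  shows "(\<Sum>i\<in>{1..n}. B k i * C i l) = (if k = l then 1 else 0)"
proof -
  have times_CB: "(\<Sum>k\<in>{1..n}. (\<Sum>i\<in>{1..n}. y i * C i k) * B k j) = y j" if "j \<in> {1..n}" for y j
  proof -
    have "(\<Sum>k\<in>{1..n}. (\<Sum>i\<in>{1..n}. y i * C i k) * B k j) =
        (\<Sum>i\<in>{1..n}. y i * (\<Sum>k\<in>{1..n}. C i k * B k j))"
      unfolding sum_distrib_left sum_distrib_right
      by (subst sum.swap) (simp add: mult.assoc)
    also have "\<dots> = (\<Sum>i\<in>{1..n}. if i = j then y i else 0)"
      using that by (intro sum.cong) (auto simp: CB simp del: One_nat_def)
    also have "\<dots> = y j" using that by simp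
    finally show ?thesis .
  qed
  \<comment> \<open>Index 0 holds the unit row, the indices from 1 on hold the rows of
    \<open>C\<close>.\<close>
  define a where "a j = (if j = 0 then (\<lambda>l. if k = l then 1 else 0) else C j)" for j
  obtain x where x: "\<exists>j\<le>n. x j \<noteq> 0" "\<forall>i\<in>{1..n}. (\<Sum>j\<le>n. x j * a j i) = 0"
    using homogeneous_system_nontrivial [of n a] by blast
  have "(\<Sum>j\<le>n. x j * a j i) = (if k = i then x 0 else 0) + (\<Sum>j\<in>{1..n}. x j * C j i)" for i
    by (simp add: atMost_atLeast0 sum.atLeast_Suc_atMost a_def)
  then have rel: "(\<Sum>j\<in>{1..n}. x j * C j i) = - (if k = i then x 0 else 0)" if "i \<in> {1..n}" for i
    using x(2) that by (auto simp: eq_neg_iff_add_eq_0 add.commute simp del: One_nat_def)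
  \<comment> \<open>Without the unit row the relation would read \<open>x C = 0\<close>, hence
    \<open>x = x C B = 0\<close>.\<close>
  have x0: "x 0 \<noteq> 0"
  proof
    assume 0: "x 0 = 0"
    have "x j = 0" if "j \<in> {1..n}" for j
    proof -
      have "(\<Sum>i\<in>{1..n}. x i * C i k) = 0" if "k \<in> {1..n}" for k
        using rel [OF that] 0 by (simp split: if_splits)
      then show ?thesis
        using times_CB [OF that, of x] by (simp del: One_nat_def)
    qed
    moreover obtain j where "j \<le> n" "x j \<noteq> 0" using x(1) by blast
    ultimately show False using 0 by (cases "j = 0") auto
  qed
  define y where "y j = - inverse (x 0) * x j" for j
  have yC: "(\<Sum>j\<in>{1..n}. y j * C j i) = (if k = i then 1 else 0)" if "i \<in> {1..n}" for i
  proof -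
    have "(\<Sum>j\<in>{1..n}. y j * C j i) = - inverse (x 0) * (\<Sum>j\<in>{1..n}. x j * C j i)"
      by (simp add: y_def sum_distrib_left mult.assoc sum_negf)
    then show ?thesis using rel [OF that] x0 by simp
  qed
  have "y j = B k j" if "j \<in> {1..n}" for j
  proof -
    have "y j = (\<Sum>i\<in>{1..n}. (if k = i then 1 else 0) * B i j)"
      using times_CB [OF that, of y] yC by simp
    also have "\<dots> = (\<Sum>i\<in>{1..n}. if k = i then B i j else 0)"
      by (intro sum.cong) auto
    also have "\<dots> = B k j" using k by simp
    finally show ?thesis .
  qed
  with yC [OF l] show ?thesis by simp
qed

section \<open>Determinants of matrices with commuting rows\<close>

text \<open>
  \<open>P g\<close> stands for the product of the \<open>b k (g k)\<close>, and \<open>D c\<close> below for the determinant of the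
  matrix with rows \<open>k\<close>, columns \<open>i\<close> and entries \<open>b k (c i)\<close>: since different rows commute, the order of
  the factors in each of its terms does not matter.
\<close>

locale row_expansion =
  fixes n :: nat and P :: "(nat \<Rightarrow> 'a::one) \<Rightarrow> 'f::division_ring" and b :: "nat \<Rightarrow> 'a \<Rightarrow> 'f"
  assumes split: "k \<in> {1..n} \<Longrightarrow> P (g(k := x)) = P (g(k := 1)) * b k x"
    and row_commute: "k \<in> {1..n} \<Longrightarrow> l \<in> {1..n} \<Longrightarrow> k \<noteq> l \<Longrightarrow> b k x * b l y = b l y * b k x"
begin

definition D :: "(nat \<Rightarrow> 'a) \<Rightarrow> 'f" where
  "D c = (\<Sum>\<sigma> | \<sigma> permutes {1..n}. of_int (sign \<sigma>) * P (c \<circ> \<sigma>))"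

lemma D_permute:
  assumes "\<tau> permutes {1..n}"
  shows "D (c \<circ> \<tau>) = of_int (sign \<tau>) * D c"
proof -
  have perm: "permutation \<sigma>" if "\<sigma> permutes {1..n}" for \<sigma>
    using that permutation_permutes by auto
  have "D c = (\<Sum>\<sigma> | \<sigma> permutes {1..n}. of_int (sign (\<tau> \<circ> \<sigma>)) * P (c \<circ> (\<tau> \<circ> \<sigma>)))"
    unfolding D_def by (rule sum.reindex_bij_betw [symmetric])
      (rule bij_betw_byWitness [where f' = "\<lambda>\<sigma>. inv_into UNIV \<tau> \<circ> \<sigma>"],
        auto simp: fun_eq_iff permutes_inverses [OF assms] simp del: One_nat_def
          intro: permutes_compose [OF _ assms] permutes_compose [OF _ permutes_inv [OF assms]])
  also have "\<dots> = of_int (sign \<tau>) * D (c \<circ> \<tau>)"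
    unfolding D_def sum_distrib_left using assms
    by (intro sum.cong) (auto simp: sign_compose perm o_assoc mult.assoc)
  finally have "of_int (sign \<tau>) * D c = of_int (sign \<tau> * sign \<tau>) * D (c \<circ> \<tau>)"
    by (simp add: mult.assoc del: sign_idempotent)
  then show ?thesis by simp
qed

text \<open>
  The terms are paired off, instead of deriving \<open>D c = - D c\<close>, so that the characteristic may be 2.
\<close>

lemma D_repeated:
  assumes ij: "i \<in> {1..n}" "j \<in> {1..n}" "i \<noteq> j" and eq: "c i = c j"
  shows "D c = 0"
proof -
  let ?S = "{\<sigma>. \<sigma> permutes {1..n}}"
  let ?E = "{\<sigma>\<in>?S. evenperm \<sigma>}" and ?O = "{\<sigma>\<in>?S. \<not> evenperm \<sigma>}"
  let ?t = "transpose i j"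
  let ?w = "\<lambda>\<sigma>. of_int (sign \<sigma>) * P (c \<circ> \<sigma>)"
  have t: "?t permutes {1..n}" using ij by (simp add: permutes_swap_id)
  have ct: "c \<circ> ?t = c" using eq by (auto simp: fun_eq_iff transpose_def)
  have perm: "permutation \<sigma>" if "\<sigma> permutes {1..n}" for \<sigma>
    using that permutation_permutes by auto
  have ev: "evenperm (?t \<circ> \<sigma>) \<longleftrightarrow> \<not> evenperm \<sigma>" if "\<sigma> permutes {1..n}" for \<sigma>
    using ij(3) by (simp add: evenperm_comp perm [OF that] permutation_swap_id evenperm_swap)
  have bij: "bij_betw (\<lambda>\<sigma>. ?t \<circ> \<sigma>) ?E ?O"
    by (rule bij_betw_byWitness [where f' = "\<lambda>\<sigma>. ?t \<circ> \<sigma>"])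
      (auto intro: permutes_compose [OF _ t] simp: ev o_assoc simp del: One_nat_def)
  have "sum ?w ?O = (\<Sum>\<sigma>\<in>?E. ?w (?t \<circ> \<sigma>))"
    by (rule sum.reindex_bij_betw [OF bij, symmetric])
  also have "\<dots> = - sum ?w ?E"
    unfolding sum_negf [symmetric]
    by (rule sum.cong) (auto simp: sign_def ev ct o_assoc)
  finally have "sum ?w ?E + sum ?w ?O = 0" by simp
  moreover have "D c = sum ?w ?E + sum ?w ?O"
    unfolding D_def by (subst sum.union_disjoint [symmetric])
      (auto simp: finite_permutations intro!: arg_cong [where f = "sum ?w"])
  ultimately show ?thesis by simp
qed

section \<open>Expansion along one and two columns\<close>

text \<open>The signed left coefficient of the entry in row \<open>k\<close> and column
  \<open>i\<close>; the 1 in slot \<open>k\<close> erases the only occurrence of column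
  \<open>i\<close>.\<close>

definition cofactor :: "(nat \<Rightarrow> 'a) \<Rightarrow> nat \<Rightarrow> nat \<Rightarrow> 'f" where
  "cofactor c i k = (\<Sum>\<sigma> | \<sigma> permutes {1..n}.
     if \<sigma> k = i then of_int (sign \<sigma>) * P ((c \<circ> \<sigma>)(k := 1)) else 0)"

definition cofactor2 :: "(nat \<Rightarrow> 'a) \<Rightarrow> nat \<Rightarrow> nat \<Rightarrow> nat \<Rightarrow> nat \<Rightarrow> 'f" where
  "cofactor2 c i j k l = (\<Sum>\<sigma> | \<sigma> permutes {1..n}.
     if \<sigma> k = i \<and> \<sigma> l = j then of_int (sign \<sigma>) * P ((c \<circ> \<sigma>)(k := 1, l := 1)) else 0)"

lemma permutes_eq_iff:
  assumes "\<sigma> permutes {1..n}"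
  shows "\<sigma> k = i \<longleftrightarrow> k = inv_into UNIV \<sigma> i"
  using permutes_inverses [OF assms] by metis

text \<open>Each permutation meets column \<open>i\<close> in exactly one row,
  \<open>inv_into UNIV \<sigma> i\<close>, and \<open>split\<close> moves that entry to the right
  end of the product.\<close>

lemma D_upd:
  assumes i: "i \<in> {1..n}"
  shows "D (c(i := x)) = (\<Sum>k\<in>{1..n}. cofactor c i k * b k x)"
proof -
  have "(\<Sum>k\<in>{1..n}. cofactor c i k * b k x) = (\<Sum>\<sigma> | \<sigma> permutes {1..n}. \<Sum>k\<in>{1..n}.
      if k = inv_into UNIV \<sigma> i then of_int (sign \<sigma>) * P ((c \<circ> \<sigma>)(k := x)) else 0)"
    unfolding cofactor_def sum_distrib_right
    by (subst sum.swap) (auto intro!: sum.cong simp: mult.assoc permutes_eq_iff split [of _ _ x])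
  also have "\<dots> = (\<Sum>\<sigma> | \<sigma> permutes {1..n}. of_int (sign \<sigma>) * P (c(i := x) \<circ> \<sigma>))"
  proof (rule sum.cong [OF refl], clarify)
    fix \<sigma> assume \<sigma>: "\<sigma> permutes {1..n}"
    have "inv_into UNIV \<sigma> i \<in> {1..n}" using permutes_in_image [OF permutes_inv [OF \<sigma>]] i by blast
    moreover have "(c \<circ> \<sigma>)(inv_into UNIV \<sigma> i := x) = c(i := x) \<circ> \<sigma>"
      using permutes_eq_iff [OF \<sigma>] by (auto simp: fun_eq_iff)
    ultimately show "(\<Sum>k\<in>{1..n}. if k = inv_into UNIV \<sigma> i then of_int (sign \<sigma>) * P ((c \<circ> \<sigma>)(k := x)) else 0)
        = of_int (sign \<sigma>) * P (c(i := x) \<circ> \<sigma>)"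
      by simp
  qed
  finally show ?thesis by (simp add: D_def)
qed

lemma D_upd2:
  assumes i: "i \<in> {1..n}" and j: "j \<in> {1..n}" and ij: "i \<noteq> j"
  shows "D (c(i := x, j := y)) =
    (\<Sum>k\<in>{1..n}. \<Sum>l\<in>{1..n}. cofactor2 c i j k l * (b k x * b l y))"
proof -
  let ?S = "{\<sigma>. \<sigma> permutes {1..n}}"
  let ?w = "\<lambda>\<sigma> k l. of_int (sign \<sigma>) * P ((c \<circ> \<sigma>)(k := x, l := y))"
  \<comment> \<open>Row \<open>l\<close> is split off first, then row \<open>k\<close> with slot
    \<open>l\<close> already set to 1.\<close>
  have split2: "P (g(k := 1, l := 1)) * (b k x * b l y) = P (g(k := x, l := y))"
    if "k \<in> {1..n}" "l \<in> {1..n}" "k \<noteq> l" for g k l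
    using that split [of k "g(l := 1)" x] split [of l "g(k := x)" y]
    by (simp add: fun_upd_twist mult.assoc)
  \<comment> \<open>For \<open>k = l\<close> both sides are 0 because \<open>i \<noteq> j\<close>.
    The nested conditionals let the sums over \<open>l\<close> and \<open>k\<close> collapse one
    after the other.\<close>
  have "cofactor2 c i j k l * (b k x * b l y) =
      (\<Sum>\<sigma>\<in>?S. if k = inv_into UNIV \<sigma> i then if l = inv_into UNIV \<sigma> j then ?w \<sigma> k l else 0 else 0)"
    if "k \<in> {1..n}" "l \<in> {1..n}" for k l
    unfolding cofactor2_def sum_distrib_right
  proof (rule sum.cong [OF refl], clarify)
    fix \<sigma> assume \<sigma>: "\<sigma> permutes {1..n}"
    show "(if \<sigma> k = i \<and> \<sigma> l = j then of_int (sign \<sigma>) * P ((c \<circ> \<sigma>)(k := 1, l := 1)) else 0) *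
          (b k x * b l y) = (if k = inv_into UNIV \<sigma> i then if l = inv_into UNIV \<sigma> j then ?w \<sigma> k l else 0 else 0)"
      using permutes_eq_iff [OF \<sigma>, of k i] permutes_eq_iff [OF \<sigma>, of l j] ij
        split2 [OF that, of "c \<circ> \<sigma>"]
      by (cases "k = l") (auto simp: mult.assoc)
  qed
  then have "(\<Sum>k\<in>{1..n}. \<Sum>l\<in>{1..n}. cofactor2 c i j k l * (b k x * b l y)) =
      (\<Sum>k\<in>{1..n}. \<Sum>l\<in>{1..n}. \<Sum>\<sigma>\<in>?S.
        if k = inv_into UNIV \<sigma> i then if l = inv_into UNIV \<sigma> j then ?w \<sigma> k l else 0 else 0)"
    by (intro sum.cong) auto
  also have "\<dots> = (\<Sum>k\<in>{1..n}. \<Sum>\<sigma>\<in>?S. \<Sum>l\<in>{1..n}.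
        if k = inv_into UNIV \<sigma> i then if l = inv_into UNIV \<sigma> j then ?w \<sigma> k l else 0 else 0)"
    by (rule sum.cong [OF refl]) (rule sum.swap)
  also have "\<dots> = (\<Sum>\<sigma>\<in>?S. \<Sum>k\<in>{1..n}. \<Sum>l\<in>{1..n}.
        if k = inv_into UNIV \<sigma> i then if l = inv_into UNIV \<sigma> j then ?w \<sigma> k l else 0 else 0)"
    by (rule sum.swap)
  also have "\<dots> = (\<Sum>\<sigma>\<in>?S. of_int (sign \<sigma>) * P (c(i := x, j := y) \<circ> \<sigma>))"
  proof (rule sum.cong [OF refl], clarify)
    fix \<sigma> assume \<sigma>: "\<sigma> permutes {1..n}"
    have inv: "inv_into UNIV \<sigma> i \<in> {1..n}" "inv_into UNIV \<sigma> j \<in> {1..n}"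
      using permutes_in_image [OF permutes_inv [OF \<sigma>]] i j by blast+
    have "(c \<circ> \<sigma>)(inv_into UNIV \<sigma> i := x, inv_into UNIV \<sigma> j := y) = c(i := x, j := y) \<circ> \<sigma>"
      using permutes_eq_iff [OF \<sigma>] by (auto simp: fun_eq_iff)
    moreover have "(\<Sum>l\<in>{1..n}. if k = inv_into UNIV \<sigma> i then if l = inv_into UNIV \<sigma> j then ?w \<sigma> k l else 0 else 0) =
        (if k = inv_into UNIV \<sigma> i then ?w \<sigma> k (inv_into UNIV \<sigma> j) else 0)" for k
      using inv by simp
    ultimately show "(\<Sum>k\<in>{1..n}. \<Sum>l\<in>{1..n}.
          if k = inv_into UNIV \<sigma> i then if l = inv_into UNIV \<sigma> j then ?w \<sigma> k l else 0 else 0) =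
        of_int (sign \<sigma>) * P (c(i := x, j := y) \<circ> \<sigma>)"
      using inv by simp
  qed
  finally show ?thesis by (simp add: D_def)
qed

section \<open>Cramer's rule and commuting solutions\<close>

lemma cramer:
  assumes D: "D c \<noteq> 0" and k: "k \<in> {1..n}"
  shows "(\<Sum>i\<in>{1..n}. b k (c i) * (inverse (D c) * D (c(i := v)))) = b k v"
proof -
  define C where "C i k = inverse (D c) * cofactor c i k" for i k
  have C: "(\<Sum>k\<in>{1..n}. C i k * b k x) = inverse (D c) * D (c(i := x))" if "i \<in> {1..n}" for i x
    by (simp add: C_def D_upd [OF that] sum_distrib_left mult.assoc)
  \<comment> \<open>Off the diagonal the expansion gives a determinant whose columns
    \<open>i\<close> and \<open>j\<close> are both \<open>c j\<close>.\<close>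
  have CB: "(\<Sum>k\<in>{1..n}. C i k * b k (c j)) = (if i = j then 1 else 0)"
    if "i \<in> {1..n}" "j \<in> {1..n}" for i j
  proof (cases "i = j")
    case False
    with that have "D (c(i := c j)) = 0" by (intro D_repeated [of i j]) auto
    with False show ?thesis using C [OF that(1)] by simp
  qed (use C [OF that(1)] D in simp)
  have BC: "(\<Sum>i\<in>{1..n}. b k (c i) * C i l) = (if k = l then 1 else 0)" if "l \<in> {1..n}" for l
    using left_inverse_imp_right_inverse [of n C "\<lambda>k j. b k (c j)", OF CB k that] by simp
  have "(\<Sum>i\<in>{1..n}. b k (c i) * (inverse (D c) * D (c(i := v)))) =
      (\<Sum>i\<in>{1..n}. b k (c i) * (\<Sum>l\<in>{1..n}. C i l * b l v))"
    by (simp add: C del: One_nat_def)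
  also have "\<dots> = (\<Sum>l\<in>{1..n}. (\<Sum>i\<in>{1..n}. b k (c i) * C i l) * b l v)"
    unfolding sum_distrib_left sum_distrib_right by (subst sum.swap) (simp add: mult.assoc)
  also have "\<dots> = (\<Sum>l\<in>{1..n}. if k = l then b l v else 0)"
    by (intro sum.cong) (auto simp: BC simp del: One_nat_def)
  also have "\<dots> = b k v" using k by simp
  finally show ?thesis .
qed

lemma cramer_solutions_commute:
  fixes v :: 'a
  assumes D: "D c \<noteq> 0" and i: "i \<in> {1..n}" and j: "j \<in> {1..n}"
  defines "H \<equiv> \<lambda>i. inverse (D c) * D (c(i := v))"
  shows "H i * H j = H j * H i"
proof (cases "i = j")
  case False
  note ij = i j False
  let ?I = "{1..n}"
  have sol: "(\<Sum>p\<in>?I. b k (c p) * H p) = b k v" if "k \<in> ?I" for k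
    using cramer [OF D that] by (simp add: H_def)
  \<comment> \<open>\<open>b k v\<close> is moved past \<open>b l (c q)\<close> before it is
    expanded, so that the factors \<open>H\<close> collect on the right and none has to pass an
    entry.\<close>
  have prod: "b k v * b l v = (\<Sum>p\<in>?I. \<Sum>q\<in>?I. b k (c p) * b l (c q) * (H p * H q))"
    if kl: "k \<in> ?I" "l \<in> ?I" "k \<noteq> l" for k l
  proof -
    have "b k v * b l v = (\<Sum>q\<in>?I. b l (c q) * b k v * H q)"
      by (simp add: sol [OF kl(2), symmetric] sum_distrib_left row_commute [OF kl] mult.assoc [symmetric])
    also have "\<dots> = (\<Sum>q\<in>?I. \<Sum>p\<in>?I. b k (c p) * b l (c q) * (H p * H q))"
      unfolding sol [OF kl(1), symmetric] sum_distrib_left sum_distrib_right row_commute [OF kl]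
      by (simp add: mult.assoc)
    also have "\<dots> = (\<Sum>p\<in>?I. \<Sum>q\<in>?I. b k (c p) * b l (c q) * (H p * H q))"
      by (rule sum.swap)
    finally show ?thesis .
  qed
  \<comment> \<open>No permutation sends \<open>k\<close> to both \<open>i\<close> and
    \<open>j\<close>; this disposes of the terms with \<open>k = l\<close>, which
    \<open>prod\<close> does not cover.\<close>
  have diag: "cofactor2 c i j k k = 0" for k
    unfolding cofactor2_def using False by (intro sum.neutral) auto
  let ?M = "cofactor2 c i j"
  have "0 = D (c(i := v, j := v))"
    using D_repeated [OF ij, of "c(i := v, j := v)"] by simp
  also have "\<dots> = (\<Sum>k\<in>?I. \<Sum>l\<in>?I. ?M k l * (b k v * b l v))"
    by (rule D_upd2 [OF ij])
  also have "\<dots> = (\<Sum>k\<in>?I. \<Sum>l\<in>?I. \<Sum>p\<in>?I. \<Sum>q\<in>?I.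
      ?M k l * (b k (c p) * b l (c q)) * (H p * H q))"
  proof (intro sum.cong refl)
    fix k l assume kl: "k \<in> ?I" "l \<in> ?I"
    show "?M k l * (b k v * b l v) = (\<Sum>p\<in>?I. \<Sum>q\<in>?I.
      ?M k l * (b k (c p) * b l (c q)) * (H p * H q))"
    proof (cases "k = l")
      case True then show ?thesis by (simp add: diag)
    next
      case False
      then show ?thesis using prod [OF kl] by (simp add: sum_distrib_left mult.assoc)
    qed
  qed
  \<comment> \<open>The sums over \<open>k\<close> and \<open>l\<close> move inside, where they form
    the expansion of a determinant along the columns \<open>i\<close> and \<open>j\<close>.\<close>
  also have "\<dots> = (\<Sum>p\<in>?I. \<Sum>q\<in>?I. \<Sum>k\<in>?I. \<Sum>l\<in>?I.
      ?M k l * (b k (c p) * b l (c q)) * (H p * H q))" (is "?lhs = _")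
  proof -
    have "?lhs = (\<Sum>k\<in>?I. \<Sum>p\<in>?I. \<Sum>q\<in>?I. \<Sum>l\<in>?I.
        ?M k l * (b k (c p) * b l (c q)) * (H p * H q))"
    proof (rule sum.cong [OF refl])
      fix k
      have "(\<Sum>l\<in>?I. \<Sum>p\<in>?I. \<Sum>q\<in>?I. ?M k l * (b k (c p) * b l (c q)) * (H p * H q)) =
          (\<Sum>p\<in>?I. \<Sum>l\<in>?I. \<Sum>q\<in>?I. ?M k l * (b k (c p) * b l (c q)) * (H p * H q))"
        by (rule sum.swap)
      also have "\<dots> = (\<Sum>p\<in>?I. \<Sum>q\<in>?I. \<Sum>l\<in>?I. ?M k l * (b k (c p) * b l (c q)) * (H p * H q))"
        by (rule sum.cong [OF refl]) (rule sum.swap)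
      finally show "(\<Sum>l\<in>?I. \<Sum>p\<in>?I. \<Sum>q\<in>?I. ?M k l * (b k (c p) * b l (c q)) * (H p * H q)) =
        (\<Sum>p\<in>?I. \<Sum>q\<in>?I. \<Sum>l\<in>?I. ?M k l * (b k (c p) * b l (c q)) * (H p * H q))" .
    qed
    also have "\<dots> = (\<Sum>p\<in>?I. \<Sum>k\<in>?I. \<Sum>q\<in>?I. \<Sum>l\<in>?I.
        ?M k l * (b k (c p) * b l (c q)) * (H p * H q))"
      by (rule sum.swap)
    also have "\<dots> = (\<Sum>p\<in>?I. \<Sum>q\<in>?I. \<Sum>k\<in>?I. \<Sum>l\<in>?I.
        ?M k l * (b k (c p) * b l (c q)) * (H p * H q))"
      by (rule sum.cong [OF refl]) (rule sum.swap)
    finally show ?thesis .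
  qed
  also have "\<dots> = (\<Sum>p\<in>?I. \<Sum>q\<in>?I. D (c(i := c p, j := c q)) * (H p * H q))"
    by (simp add: D_upd2 [OF ij] sum_distrib_right)
  also have "\<dots> = (\<Sum>p\<in>?I. \<Sum>q\<in>?I.
     (if p = i then if q = j then D c * (H i * H j) else 0 else 0) -
     (if p = j then if q = i then D c * (H j * H i) else 0 else 0))"
  proof (intro sum.cong refl)
    fix p q assume pq: "p \<in> ?I" "q \<in> ?I"
    let ?c = "c(i := c p, j := c q)"
    \<comment> \<open>Only \<open>(i, j)\<close> and \<open>(j, i)\<close> survive; any other pair
      repeats a column, either because \<open>p = q\<close> or because column \<open>p\<close> or
      \<open>q\<close> also remains in its own place.\<close>
    consider "p = i" "q = j" | "p = j" "q = i" | "p = q" | "p \<notin> {i, j}" | "q \<notin> {i, j}"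
      by blast
    then show "D ?c * (H p * H q) =
       (if p = i then if q = j then D c * (H i * H j) else 0 else 0) -
       (if p = j then if q = i then D c * (H j * H i) else 0 else 0)"
    proof cases
      case 1 then show ?thesis using False by simp
    next
      case 2
      have "?c = c \<circ> transpose i j" using 2 False by (auto simp: fun_eq_iff transpose_def)
      then have "D ?c = - D c"
        using D_permute [OF permutes_swap_id [OF i j], of c] False by (simp add: sign_swap_id)
      then show ?thesis using 2 False by simp
    next
      case 3
      then have "D ?c = 0" using False by (intro D_repeated [OF ij]) auto
      then show ?thesis using 3 False by auto
    next
      case 4
      then have "D ?c = 0" using False pq i by (intro D_repeated [of i p]) auto
      then show ?thesis using 4 by auto
    next
      case 5
      then have "D ?c = 0" using False pq j by (intro D_repeated [of j q]) auto
      then show ?thesis using 5 by auto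
    qed
  qed
  also have "\<dots> = D c * (H i * H j) - D c * (H j * H i)"
  proof -
    have "(\<Sum>p\<in>?I. \<Sum>q\<in>?I. if p = r then if q = s then z else 0 else 0) = z"
      if "r \<in> ?I" "s \<in> ?I" for r s and z :: 'f
    proof -
      have "(\<Sum>q\<in>?I. if p = r then if q = s then z else 0 else 0) = (if p = r then z else 0)" for p
        using that by simp
      then show ?thesis using that by simp
    qed
    then show ?thesis using i j by (simp add: sum_subtractf del: atLeastAtMost_iff)
  qed
  finally show ?thesis using D by simp
qed simp

end

section \<open>Additive maps on the tensor power and nonvanishing\<close>

context unital_assoc_algebra
begin

lemma pure_tensor_closed: "pure_tensor scale n g \<in> carrier (tensor_power scale n)"
proof -
  have "free_basis n g \<in> carrier (free_algebra n :: ((nat \<Rightarrow> 'a) \<Rightarrow>\<^sub>0 'k) ring)"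
    by (simp add: free_algebra_def free_basis_def del: One_nat_def)
  then show ?thesis
    by (auto simp: pure_tensor_def tensor_power_def FactRing_def A_RCOSETS_def')
qed

lemma additive_zero:
  fixes h :: "_ \<Rightarrow> 'b::ring_1"
  assumes "\<And>U V. U \<in> carrier (tensor_power scale n) \<Longrightarrow> V \<in> carrier (tensor_power scale n) \<Longrightarrow>
      h (U \<oplus>\<^bsub>tensor_power scale n\<^esub> V) = h U + h V"
  shows "h \<zero>\<^bsub>tensor_power scale n\<^esub> = 0"
proof -
  interpret T: ring "tensor_power scale n" by (rule ring_tensor_power)
  show ?thesis using assms [OF T.zero_closed T.zero_closed] by simp
qed

text \<open>Stated for additive maps because it serves both \<open>\<phi>\<close> and the functional
  of \<open>multilinear_functional\<close>.\<close>

lemma additive_antisym_tensor: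
  fixes h :: "_ \<Rightarrow> 'b::ring_1"
  assumes add: "\<And>U V. U \<in> carrier (tensor_power scale n) \<Longrightarrow> V \<in> carrier (tensor_power scale n) \<Longrightarrow>
      h (U \<oplus>\<^bsub>tensor_power scale n\<^esub> V) = h U + h V"
  shows "h (antisym_tensor scale n g) =
    (\<Sum>\<sigma> | \<sigma> permutes {1..n}. of_int (sign \<sigma>) * h (pure_tensor scale n (g \<circ> \<sigma>)))"
proof -
  let ?T = "tensor_power scale n"
  interpret T: ring ?T by (rule ring_tensor_power)
  have h0: "h \<zero>\<^bsub>?T\<^esub> = 0" using add by (rule additive_zero)
  have neg: "h (\<ominus>\<^bsub>?T\<^esub> U) = - h U" if "U \<in> carrier ?T" for U
    using add [of U "\<ominus>\<^bsub>?T\<^esub> U"] that h0 by (simp add: T.r_neg eq_neg_iff_add_eq_0 add.commute)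
  have sgn: "h ([sign \<sigma>] \<cdot>\<^bsub>?T\<^esub> U) = of_int (sign \<sigma>) * h U" if "U \<in> carrier ?T"
    for \<sigma> :: "nat \<Rightarrow> nat" and U
    using that by (cases \<sigma> rule: sign_cases) (simp_all add: T.add.int_pow_neg neg)
  have "h (finsum ?T u S) = (\<Sum>s\<in>S. h (u s))" if "finite S" "u \<in> S \<rightarrow> carrier ?T"
    for u and S :: "(nat \<Rightarrow> nat) set"
    using that by (induction S) (simp_all add: h0 add Pi_iff)
  then show ?thesis
    by (simp add: antisym_tensor_def finite_permutations sgn pure_tensor_closed Pi_iff)
qed

text \<open>Universal property of the tensor power for a product of linear forms: the linear
  extension \<open>L\<close> to the free space kills the multilinearity relations and so descends to
  cosets.\<close>

lemma multilinear_functional: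
  fixes e :: "nat \<Rightarrow> 'a \<Rightarrow> 'k"
  assumes e_add: "\<And>i x y. e i (x + y) = e i x + e i y"
    and e_scale: "\<And>i c x. e i (scale c x) = c * e i x"
  obtains h where "\<And>U V. U \<in> carrier (tensor_power scale n) \<Longrightarrow> V \<in> carrier (tensor_power scale n) \<Longrightarrow>
      h (U \<oplus>\<^bsub>tensor_power scale n\<^esub> V) = h U + h V"
    "\<And>g. h (pure_tensor scale n g) = (\<Prod>i\<in>{1..n}. e i (g i))"
proof -
  let ?K = "tensor_kernel scale n" and ?R = "free_algebra n :: ((nat \<Rightarrow> 'a) \<Rightarrow>\<^sub>0 'k) ring"
  interpret I: ideal ?K ?R by (rule ideal_tensor_kernel)
  define w where "w g = (\<Prod>i\<in>{1..n}. e i (g i))" for g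
  define L where "L p = (\<Sum>g\<in>Poly_Mapping.keys p. Poly_Mapping.lookup p g * w g)" for p
  have L_add: "L (p + q) = L p + L q" for p q
    unfolding L_def by (rule setsum_keys_plus_distrib) (simp_all add: distrib_right)
  have L_single: "L (Poly_Mapping.single g a) = a * w g" for g a
    by (simp add: L_def)
  have L_0: "L 0 = 0" by (simp add: L_def)
  have L_scale: "L (free_scale c p) = c * L p" for c p
    by (induction p rule: poly_mapping_single_induct [where S = UNIV])
      (simp_all add: L_0 L_add L_single free_scale_single free.scale_right_distrib algebra_simps)
  have L_diff: "L (p - q) = L p - L q" for p q
    using L_add [of "p - q" q] by simp
  have L_basis: "L (free_basis n g) = w g" for g
    by (simp add: free_basis_def L_single) (simp add: w_def)
  \<comment> \<open>With the other slots fixed, \<open>w\<close> is \<open>e i\<close> times a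
    constant; this is its multilinearity.\<close>
  have w_upd: "w (g(i := x)) = e i x * (\<Prod>j\<in>{1..n} - {i}. e j (g j))" if "i \<in> {1..n}" for g i x
    unfolding w_def using that by (subst prod.remove [of _ i]) auto
  have "multilinear_relations scale n \<subseteq> {p. L p = 0}"
    unfolding multilinear_relations_def
    by (auto simp: L_diff L_add L_scale L_basis w_upd e_add e_scale distrib_right mult.assoc
        simp del: One_nat_def atLeastAtMost_iff)
  moreover have "free.subspace {p. L p = 0}"
    by (simp add: free.subspace_def L_0 L_add L_scale)
  ultimately have L_kernel: "L p = 0" if "p \<in> ?K" for p
    using that unfolding tensor_kernel_def using free.span_minimal by blast
  \<comment> \<open>Any representative serves, since \<open>L\<close> vanishes on the
    kernel.\<close>
  define h where "h U = L (SOME p. p \<in> U)" for U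
  have h: "h (?K +>\<^bsub>?R\<^esub> p) = L p" if "p \<in> carrier ?R" for p
  proof -
    have "(SOME q. q \<in> ?K +>\<^bsub>?R\<^esub> p) \<in> ?K +>\<^bsub>?R\<^esub> p"
      using I.a_rcos_self [OF that] by (rule someI)
    then show ?thesis
      unfolding h_def a_r_coset_def' by (auto simp: free_algebra_def L_add L_kernel)
  qed
  show thesis
  proof
    fix U V assume "U \<in> carrier (tensor_power scale n)" "V \<in> carrier (tensor_power scale n)"
    then obtain p q where pq: "p \<in> carrier ?R" "q \<in> carrier ?R"
      and UV: "U = ?K +>\<^bsub>?R\<^esub> p" "V = ?K +>\<^bsub>?R\<^esub> q"
      by (auto simp: tensor_power_def FactRing_def A_RCOSETS_def')
    have "U \<oplus>\<^bsub>tensor_power scale n\<^esub> V = ?K +>\<^bsub>?R\<^esub> (p \<oplus>\<^bsub>?R\<^esub> q)"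
      using pq UV by (simp add: tensor_power_def FactRing_def I.a_rcos_sum)
    then show "h (U \<oplus>\<^bsub>tensor_power scale n\<^esub> V) = h U + h V"
      using pq UV I.a_closed [OF pq] by (simp add: h) (simp add: free_algebra_def L_add)
  next
    fix g
    have "free_basis n g \<in> carrier ?R"
      by (simp add: free_algebra_def free_basis_def del: One_nat_def)
    then show "h (pure_tensor scale n g) = (\<Prod>i\<in>{1..n}. e i (g i))"
      by (simp add: pure_tensor_def h L_basis) (simp add: w_def)
  qed
qed

text \<open>The product of the coordinate forms dual to \<open>f\<close> is 1 on the term of the
  identity and 0 on every other term, so it takes the value 1 on the sum in any
  characteristic.\<close>

lemma antisym_tensor_nonzero:
  assumes inj: "inj_on f {1..n}" and indep: "independent (f ` {1..n})"
  shows "antisym_tensor scale n f \<noteq> \<zero>\<^bsub>tensor_power scale n\<^esub>"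
proof
  assume zero: "antisym_tensor scale n f = \<zero>\<^bsub>tensor_power scale n\<^esub>"
  \<comment> \<open>Extending to a basis of the whole algebra makes the coordinates along the
    \<open>f i\<close> linear forms on all of it.\<close>
  define E where "E = extend_basis (f ` {1..n})"
  have E: "independent E" "span E = UNIV" "f ` {1..n} \<subseteq> E"
    unfolding E_def using independent_extend_basis [OF indep] span_extend_basis [OF indep]
      extend_basis_superset [OF indep] by blast+
  define e where "e i x = representation E x (f i)" for i x
  have e_f: "e i (f j) = (if i = j then 1 else 0)" if "i \<in> {1..n}" "j \<in> {1..n}" for i j
    using that E inj_onD [OF inj, of i j] by (auto simp: e_def representation_basis image_subset_iff)
  have "e i (x + y) = e i x + e i y" "e i (scale c x) = c * e i x" for i x y c
    using E by (simp_all add: e_def representation_add representation_scale)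
  then obtain h where h:
    "\<And>U V. U \<in> carrier (tensor_power scale n) \<Longrightarrow> V \<in> carrier (tensor_power scale n) \<Longrightarrow>
      h (U \<oplus>\<^bsub>tensor_power scale n\<^esub> V) = h U + h V"
    "\<And>g. h (pure_tensor scale n g) = (\<Prod>i\<in>{1..n}. e i (g i))"
    using multilinear_functional [of e n] by blast
  have "h (antisym_tensor scale n f) =
      (\<Sum>\<sigma> | \<sigma> permutes {1..n}. of_int (sign \<sigma>) * (\<Prod>i\<in>{1..n}. e i (f (\<sigma> i))))"
    using additive_antisym_tensor [OF h(1)] by (simp add: h(2))
  also have "\<dots> = (\<Sum>\<sigma> | \<sigma> permutes {1..n}. if \<sigma> = id then 1 else 0)"
  proof (rule sum.cong [OF refl], clarify)
    fix \<sigma> assume \<sigma>: "\<sigma> permutes {1..n}"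
    have ef: "e i (f (\<sigma> i)) = (if i = \<sigma> i then 1 else 0)" if "i \<in> {1..n}" for i
      using that permutes_in_image [OF \<sigma>] by (intro e_f) blast+
    show "of_int (sign \<sigma>) * (\<Prod>i\<in>{1..n}. e i (f (\<sigma> i))) = (if \<sigma> = id then 1 else 0)"
    proof (cases "\<sigma> = id")
      case True
      have "e i (f (\<sigma> i)) = 1" if "i \<in> {1..n}" for i
        using ef [OF that] True by simp
      then have "(\<Prod>i\<in>{1..n}. e i (f (\<sigma> i))) = 1"
        by (intro prod.neutral) blast
      with True show ?thesis by (simp add: sign_id)
    next
      case False
      then obtain i where "\<sigma> i \<noteq> i" by (auto simp: fun_eq_iff)
      moreover from this have "i \<in> {1..n}" using permutes_not_in [OF \<sigma>] by blast
      ultimately have "(\<Prod>i\<in>{1..n}. e i (f (\<sigma> i))) = 0"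
        using ef [of i] by (intro prod_zero bexI [of _ i]) auto
      with False show ?thesis by simp
    qed
  qed
  also have "\<dots> = 1"
    by (simp add: finite_permutations permutes_id)
  finally have "h (antisym_tensor scale n f) = 1" .
  moreover have "h (antisym_tensor scale n f) = 0"
    unfolding zero using h(1) by (rule additive_zero)
  ultimately show False by simp
qed

end

section \<open>Omitted entries as replaced columns\<close>

text \<open>For \<open>i \<ge> 1\<close>, the cycle taking 1 to \<open>i\<close>, \<open>i\<close>
  to \<open>i - 1\<close>, and so on down to 2, which goes to 1.\<close>

definition shift_cycle :: "nat \<Rightarrow> nat \<Rightarrow> nat" where
  "shift_cycle i j = (if j = 1 then i else if j \<in> {2..i} then j - 1 else j)"

lemma shift_cycle_permutes:
  assumes "i \<in> {1..n}"
  shows "shift_cycle i permutes {1..n}"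
proof (rule bij_imp_permutes)
  show "bij_betw (shift_cycle i) {1..n} {1..n}"
    by (rule bij_betw_byWitness [where f' = "\<lambda>j. if j = i then 1 else if j < i then j + 1 else j"])
      (use assms in \<open>auto simp: shift_cycle_def\<close>)
qed (use assms in \<open>auto simp: shift_cycle_def\<close>)

text \<open>Makes the tensor omitting \<open>f i\<close> a Cramer numerator up to sign. At argument
  0 both sides are \<open>f 0\<close>, because \<open>0 - 1 = 0\<close>.\<close>

lemma omit_eq_shift_cycle:
  assumes "i \<ge> 1"
  shows "omit i f = f(i := f 0) \<circ> shift_cycle i"
  using assms by (auto simp: omit_def shift_cycle_def fun_eq_iff not_le less_Suc_eq numeral_2_eq_2)

section \<open>Reduction of the theorem to determinants\<close>

theorem theorem1p1:
  fixes scale :: "'k::field \<Rightarrow> 'a::ring_1 \<Rightarrow> 'a"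
    and n :: nat
    and \<phi> :: "((nat \<Rightarrow> 'a) \<Rightarrow>\<^sub>0 'k) set \<Rightarrow> 'f::division_ring"
    and f :: "nat \<Rightarrow> 'a"
    and H :: "nat \<Rightarrow> 'f"
  assumes algebra: "unital_assoc_algebra scale"
    and n: "n \<ge> 1"
    and \<phi>_hom: "\<phi> \<in> ring_hom (tensor_power scale n) ring_of_type_algebra"
    and \<phi>_inj: "inj_on \<phi> (carrier (tensor_power scale n))"
    and f_distinct: "inj_on f {0..n}"
    and f_independent: "\<not> module.dependent scale (f ` {0..n})"
    and H: "\<And>i. i \<le> n \<Longrightarrow> H i = inverse (\<phi> (Delta scale n f 0)) * \<phi> (Delta scale n f i)"
  shows "Delta scale n f 0 \<noteq> \<zero>\<^bsub>tensor_power scale n\<^esub> \<and>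
         (\<forall>i\<le>n. \<forall>j\<le>n. H i * H j = H j * H i)"
proof -
  interpret unital_assoc_algebra scale by (rule algebra)
  let ?T = "tensor_power scale n"
  interpret T: ring ?T by (rule ring_tensor_power)
  have \<phi>_add: "\<phi> (U \<oplus>\<^bsub>?T\<^esub> V) = \<phi> U + \<phi> V" and \<phi>_mult: "\<phi> (U \<otimes>\<^bsub>?T\<^esub> V) = \<phi> U * \<phi> V"
    if "U \<in> carrier ?T" "V \<in> carrier ?T" for U V
    using that \<phi>_hom by (simp_all add: ring_hom_def ring_of_type_algebra_def)
  define P where "P g = \<phi> (pure_tensor scale n g)" for g
  define b where "b k x = P ((\<lambda>_. 1)(k := x))" for k x
  have P_mult: "P g * P h = P (\<lambda>i. g i * h i)" for g h
    unfolding P_def by (simp add: \<phi>_mult [symmetric] pure_tensor_closed pure_tensor_mult)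
  interpret row_expansion n P b
  proof
    show "P (g(k := x)) = P (g(k := 1)) * b k x" for g k x
      unfolding b_def P_mult by (rule arg_cong [where f = P]) auto
    show "b k x * b l y = b l y * b k x" if "k \<noteq> l" for k l x y
      unfolding b_def P_mult by (rule arg_cong [where f = P]) (use that in auto)
  qed
  have antisym: "\<phi> (antisym_tensor scale n g) = D g" for g
    unfolding D_def P_def by (rule additive_antisym_tensor) (rule \<phi>_add)
  \<comment> \<open>Only the argument 0 is affected, and there \<open>0 - 1 = 0\<close>.\<close>
  have "omit 0 f = f" by (auto simp: omit_def)
  then have Delta_0: "Delta scale n f 0 = antisym_tensor scale n f"
    by (simp add: Delta_def)
  have closed: "antisym_tensor scale n g \<in> carrier ?T" for g
    unfolding antisym_tensor_def by (intro T.finsum_closed) (auto simp: pure_tensor_closed)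
  have "f ` {1..n} \<subseteq> f ` {0..n}" by auto
  with f_independent have "independent (f ` {1..n})" by (metis independent_mono)
  moreover have "inj_on f {1..n}" using f_distinct by (rule inj_on_subset) auto
  ultimately have nonzero: "antisym_tensor scale n f \<noteq> \<zero>\<^bsub>?T\<^esub>"
    using antisym_tensor_nonzero by blast
  \<comment> \<open>\<open>\<phi>\<close> sends zero to 0, so by injectivity \<open>D f = 0\<close>
    would make the tensor zero.\<close>
  have D_nonzero: "D f \<noteq> 0"
    using nonzero inj_onD [OF \<phi>_inj _ closed T.zero_closed, of f] additive_zero [of n \<phi>, OF \<phi>_add]
    by (auto simp: antisym)
  \<comment> \<open>Cramer's solution for the right-hand side \<open>f 0\<close>.\<close>
  define Z where "Z i = inverse (D f) * D (f(i := f 0))" for i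
  have H_0: "H 0 = 1"
    using H [of 0] D_nonzero by (simp add: Delta_0 antisym)
  \<comment> \<open>The factor \<open>s\<close> is the sign of the cycle; being central, it does not
    affect commutation.\<close>
  have H_Z: "\<exists>s\<in>{1, -1}. H i = s * Z i" if "i \<in> {1..n}" for i
  proof -
    have "\<phi> (Delta scale n f i) = of_int (sign (shift_cycle i)) * D (f(i := f 0))"
      using that D_permute [OF shift_cycle_permutes [OF that]]
      by (simp add: Delta_def antisym omit_eq_shift_cycle)
    then show ?thesis
      using H [of i] that by (cases "shift_cycle i" rule: sign_cases) (auto simp: Delta_0 antisym Z_def)
  qed
  have "H i * H j = H j * H i" if "i \<le> n" "j \<le> n" for i j
  proof (cases "i = 0 \<or> j = 0")
    case True
    then show ?thesis using H_0 by auto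
  next
    case False
    with that have ij: "i \<in> {1..n}" "j \<in> {1..n}" by auto
    have "Z i * Z j = Z j * Z i"
      unfolding Z_def using cramer_solutions_commute [OF D_nonzero ij] .
    with H_Z [OF ij(1)] H_Z [OF ij(2)] show ?thesis by auto
  qed
  with nonzero show ?thesis by (simp add: Delta_0)
qed

end
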